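(* Let $k$ be a field and $\mathcal{D}$ a set. Every countably generated associative differential algebra over $k$ with differential operations $\mathcal{D}$ can be embedded into a two-generated associative differential algebra over $k$ with differential operations $\mathcal{D}$. That is, for every such countably generated $A$ there exist a $\mathcal{D}$-algebra $B$ generated as a $\mathcal{D}$-algebra by two elements and an injective homomorphism of $\mathcal{D}$-algebras $A\to B$.
   Context: An associative differential algebra with differential operations $\mathcal{D}$ (a $\mathcal{D}$-algebra) over a field $k$ is an associative unital $k$-algebra $A$ together with, for each $D\in\mathcal{D}$, a $k$-linear map $D:A\to A$ satisfying $D(ab)=D(a)b+aD(b)$ for all $a,b\in A$. The operations in $\mathcal{D}$ are not assumed to commute with one another. Homomorphisms of $\mathcal{D}$-algebras are unital $k$-algebra homomorphisms commuting with every $D\in\mathcal{D}$. A $\mathcal{D}$-algebra is generated by a subset $Y$ if the smallest unital $k$-subalgebra containing $Y$ and closed under all $D\in\mathcal{D}$ is the whole algebra; it is countably generated if it is generated by an at most countable set. *)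

theory Defs
  imports "HOL-Library.Countable_Set" "HOL-Algebra.Subrings" "HOL-Algebra.Module"
begin

record ('k, 'a, 'd) diff_algebra = "('k, 'a) module" +
  der :: "'d \<Rightarrow> 'a \<Rightarrow> 'a"

text \<open>
  The set of operations is a set \<open>D\<close> rather than a whole type, so that it may be empty; the
  values of \<^term>\<open>der\<close> outside \<open>D\<close> are irrelevant.  The library locale \<open>algebra\<close> cannot be used
  here because it requires the multiplication to be commutative.
\<close>

locale diff_algebra =
  K: field K + M: module K A + A: ring A
  for K :: "('k, 'm) ring_scheme" (structure)
    and D :: "'d set"
    and A :: "('k, 'a, 'd, 'n) diff_algebra_scheme" (structure) +
  assumes smult_mult_left:
      "\<lbrakk>c \<in> carrier K; x \<in> carrier A; y \<in> carrier A\<rbrakk> \<Longrightarrow>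
        (c \<odot>\<^bsub>A\<^esub> x) \<otimes>\<^bsub>A\<^esub> y = c \<odot>\<^bsub>A\<^esub> (x \<otimes>\<^bsub>A\<^esub> y)"
    and smult_mult_right:
      "\<lbrakk>c \<in> carrier K; x \<in> carrier A; y \<in> carrier A\<rbrakk> \<Longrightarrow>
        x \<otimes>\<^bsub>A\<^esub> (c \<odot>\<^bsub>A\<^esub> y) = c \<odot>\<^bsub>A\<^esub> (x \<otimes>\<^bsub>A\<^esub> y)"
    and der_closed:
      "\<lbrakk>d \<in> D; x \<in> carrier A\<rbrakk> \<Longrightarrow> der A d x \<in> carrier A"
    and der_add:
      "\<lbrakk>d \<in> D; x \<in> carrier A; y \<in> carrier A\<rbrakk> \<Longrightarrow>
        der A d (x \<oplus>\<^bsub>A\<^esub> y) = der A d x \<oplus>\<^bsub>A\<^esub> der A d y"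
    and der_smult:
      "\<lbrakk>d \<in> D; c \<in> carrier K; x \<in> carrier A\<rbrakk> \<Longrightarrow>
        der A d (c \<odot>\<^bsub>A\<^esub> x) = c \<odot>\<^bsub>A\<^esub> der A d x"
    and der_mult:
      "\<lbrakk>d \<in> D; x \<in> carrier A; y \<in> carrier A\<rbrakk> \<Longrightarrow>
        der A d (x \<otimes>\<^bsub>A\<^esub> y) = (der A d x \<otimes>\<^bsub>A\<^esub> y) \<oplus>\<^bsub>A\<^esub> (x \<otimes>\<^bsub>A\<^esub> der A d y)"

definition diff_subalgebra ::
  "('k, 'm) ring_scheme \<Rightarrow> 'd set \<Rightarrow> ('k, 'a, 'd, 'n) diff_algebra_scheme \<Rightarrow> 'a set \<Rightarrow> bool" where
  "diff_subalgebra K D A S \<longleftrightarrow>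
     subring S A \<and> submodule S K A \<and> (\<forall>d\<in>D. \<forall>x\<in>S. der A d x \<in> S)"

definition diff_generate ::
  "('k, 'm) ring_scheme \<Rightarrow> 'd set \<Rightarrow> ('k, 'a, 'd, 'n) diff_algebra_scheme \<Rightarrow> 'a set \<Rightarrow> 'a set" where
  "diff_generate K D A Y = \<Inter> {S. diff_subalgebra K D A S \<and> Y \<subseteq> S}"

definition diff_generated_by ::
  "('k, 'm) ring_scheme \<Rightarrow> 'd set \<Rightarrow> ('k, 'a, 'd, 'n) diff_algebra_scheme \<Rightarrow> 'a set \<Rightarrow> bool" where
  "diff_generated_by K D A Y \<longleftrightarrow> Y \<subseteq> carrier A \<and> diff_generate K D A Y = carrier A"

definition countably_diff_generated ::
  "('k, 'm) ring_scheme \<Rightarrow> 'd set \<Rightarrow> ('k, 'a, 'd, 'n) diff_algebra_scheme \<Rightarrow> bool" where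
  "countably_diff_generated K D A \<longleftrightarrow> (\<exists>Y. countable Y \<and> diff_generated_by K D A Y)"

text \<open>
  The two generators are allowed to coincide: the zero algebra, whose only unital extension is
  the zero algebra, has just one element.
\<close>

definition two_diff_generated ::
  "('k, 'm) ring_scheme \<Rightarrow> 'd set \<Rightarrow> ('k, 'a, 'd, 'n) diff_algebra_scheme \<Rightarrow> bool" where
  "two_diff_generated K D A \<longleftrightarrow> (\<exists>u v. diff_generated_by K D A {u, v})"

definition diff_hom ::
  "('k, 'm) ring_scheme \<Rightarrow> 'd set \<Rightarrow> ('k, 'a, 'd, 'n) diff_algebra_scheme \<Rightarrow>
    ('k, 'b, 'd, 'o) diff_algebra_scheme \<Rightarrow> ('a \<Rightarrow> 'b) set" where
  "diff_hom K D A B =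
     {h \<in> ring_hom A B.
        (\<forall>c\<in>carrier K. \<forall>x\<in>carrier A. h (c \<odot>\<^bsub>A\<^esub> x) = c \<odot>\<^bsub>B\<^esub> h x) \<and>
        (\<forall>d\<in>D. \<forall>x\<in>carrier A. h (der A d x) = der B d (h x))}"

text \<open>
  Existence of an algebra can only be asserted over a fixed carrier type.  The terms below are the
  expressions in two generators over scalars \<open>'k\<close> and operations \<open>'d\<close>.  Every algebra generated by
  two elements is a quotient of the term algebra, hence isomorphic to one whose elements are
  classes, that is sets, of such terms.  So \<open>('k, 'd) dterm set\<close> is a carrier type that loses no
  two-generated algebra; the type itself carries no algebraic structure.
\<close>

datatype ('k, 'd) dterm =
    Gen bool
  | One
  | Add "('k, 'd) dterm" "('k, 'd) dterm"
  | Mult "('k, 'd) dterm" "('k, 'd) dterm"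
  | Scale 'k "('k, 'd) dterm"
  | Der 'd "('k, 'd) dterm"

end

theory Submission
  imports Defs
begin

text \<open>
  Let \<open>V\<close> be the \<open>K\<close>-module of functions \<open>nat list \<Rightarrow> A\<close>.  Applying the operations of \<open>A\<close>
  pointwise gives endomorphisms of \<open>V\<close>, so commutators with them make the endomorphism algebra of
  \<open>V\<close> a differential algebra, and pointwise left multiplication embeds \<open>A\<close> into it.  If the
  \<open>y n\<close> generate \<open>A\<close>, two endomorphisms that manipulate the argument as a stack of numbers suffice
  to express the left multiplication by every \<open>y n\<close>, hence by every element of \<open>A\<close>.
\<close>

subsection \<open>Differential subalgebras\<close>

context diff_algebra
begin

lemma diff_subalgebraI:
  assumes "S \<subseteq> carrier A" "\<one>\<^bsub>A\<^esub> \<in> S"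
    and "\<And>x y. \<lbrakk>x \<in> S; y \<in> S\<rbrakk> \<Longrightarrow> x \<oplus>\<^bsub>A\<^esub> y \<in> S"
    and "\<And>x y. \<lbrakk>x \<in> S; y \<in> S\<rbrakk> \<Longrightarrow> x \<otimes>\<^bsub>A\<^esub> y \<in> S"
    and smult: "\<And>c x. \<lbrakk>c \<in> carrier K; x \<in> S\<rbrakk> \<Longrightarrow> c \<odot>\<^bsub>A\<^esub> x \<in> S"
    and "\<And>d x. \<lbrakk>d \<in> D; x \<in> S\<rbrakk> \<Longrightarrow> der A d x \<in> S"
  shows "diff_subalgebra K D A S"
proof -
  \<comment> \<open>Scaling by minus one produces negatives, so closure under negation need not be
    assumed.\<close>
  have neg: "\<ominus>\<^bsub>A\<^esub> x \<in> S" if "x \<in> S" for x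
  proof -
    have "x \<in> carrier A" using that assms(1) by blast
    then have "\<ominus>\<^bsub>A\<^esub> x = (\<ominus> \<one>) \<odot>\<^bsub>A\<^esub> x"
      by (simp add: M.smult_l_minus)
    then show ?thesis using smult that by simp
  qed
  have "subring S A"
    using assms neg by (intro A.subringI) auto
  moreover have "submodule S K A"
    using assms neg subringE(2)[OF \<open>subring S A\<close>] by (intro M.submoduleI) auto
  ultimately show ?thesis
    using assms(6) unfolding diff_subalgebra_def by blast
qed

lemma carrier_diff_subalgebra: "diff_subalgebra K D A (carrier A)"
  by (rule diff_subalgebraI) (auto simp: der_closed)

end

lemma diff_subalgebraD:
  assumes "diff_subalgebra K D A S"
  shows "S \<subseteq> carrier A" "\<zero>\<^bsub>A\<^esub> \<in> S" "\<one>\<^bsub>A\<^esub> \<in> S"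
    and "\<And>x. x \<in> S \<Longrightarrow> \<ominus>\<^bsub>A\<^esub> x \<in> S"
    and "\<And>x y. \<lbrakk>x \<in> S; y \<in> S\<rbrakk> \<Longrightarrow> x \<oplus>\<^bsub>A\<^esub> y \<in> S"
    and "\<And>x y. \<lbrakk>x \<in> S; y \<in> S\<rbrakk> \<Longrightarrow> x \<otimes>\<^bsub>A\<^esub> y \<in> S"
    and "\<And>c x. \<lbrakk>c \<in> carrier K; x \<in> S\<rbrakk> \<Longrightarrow> c \<odot>\<^bsub>A\<^esub> x \<in> S"
    and "\<And>d x. \<lbrakk>d \<in> D; x \<in> S\<rbrakk> \<Longrightarrow> der A d x \<in> S"
  using assms subringE[of S A] submodule.smult_closed[of S K A]
  unfolding diff_subalgebra_def by auto

lemma (in diff_algebra) diff_generate_subalgebra: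
  assumes "Y \<subseteq> carrier A"
  shows "diff_subalgebra K D A (diff_generate K D A Y)"
proof (rule diff_subalgebraI)
  \<comment> \<open>The assumption on \<open>Y\<close> makes \<open>carrier A\<close> a member of
    the intersected family; an empty family would have intersection \<open>UNIV\<close>.\<close>
  show "diff_generate K D A Y \<subseteq> carrier A"
    using assms carrier_diff_subalgebra unfolding diff_generate_def by blast
qed (auto simp: diff_generate_def diff_subalgebraD)

lemma diff_generate_incl: "Y \<subseteq> diff_generate K D A Y"
  unfolding diff_generate_def by blast

lemma diff_generate_minimal:
  "\<lbrakk>diff_subalgebra K D A S; Y \<subseteq> S\<rbrakk> \<Longrightarrow> diff_generate K D A Y \<subseteq> S"
  unfolding diff_generate_def by blast

subsection \<open>Transport of structure\<close>

text \<open>Passing to the subset \<open>S\<close> and renaming its elements happen in one step, so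
  that \<open>\<phi>\<close> only has to be injective on \<open>S\<close>.\<close>

definition transport_alg ::
  "('a \<Rightarrow> 'b) \<Rightarrow> 'a set \<Rightarrow> ('k, 'a, 'd, 'n) diff_algebra_scheme \<Rightarrow> ('k, 'b, 'd) diff_algebra" where
  "transport_alg \<phi> S A =
     (let \<psi> = inv_into S \<phi> in
     \<lparr>carrier = \<phi> ` S,
      mult = \<lambda>x y. \<phi> (\<psi> x \<otimes>\<^bsub>A\<^esub> \<psi> y), one = \<phi> \<one>\<^bsub>A\<^esub>,
      zero = \<phi> \<zero>\<^bsub>A\<^esub>, add = \<lambda>x y. \<phi> (\<psi> x \<oplus>\<^bsub>A\<^esub> \<psi> y),
      smult = \<lambda>c x. \<phi> (c \<odot>\<^bsub>A\<^esub> \<psi> x),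
      der = \<lambda>d x. \<phi> (der A d (\<psi> x))\<rparr>)"

lemma transport_alg_simps:
  assumes "inj_on \<phi> S"
  shows "carrier (transport_alg \<phi> S A) = \<phi> ` S"
    "\<one>\<^bsub>transport_alg \<phi> S A\<^esub> = \<phi> \<one>\<^bsub>A\<^esub>"
    "\<zero>\<^bsub>transport_alg \<phi> S A\<^esub> = \<phi> \<zero>\<^bsub>A\<^esub>"
    "\<lbrakk>x \<in> S; y \<in> S\<rbrakk> \<Longrightarrow> \<phi> x \<otimes>\<^bsub>transport_alg \<phi> S A\<^esub> \<phi> y = \<phi> (x \<otimes>\<^bsub>A\<^esub> y)"
    "\<lbrakk>x \<in> S; y \<in> S\<rbrakk> \<Longrightarrow> \<phi> x \<oplus>\<^bsub>transport_alg \<phi> S A\<^esub> \<phi> y = \<phi> (x \<oplus>\<^bsub>A\<^esub> y)"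
    "x \<in> S \<Longrightarrow> c \<odot>\<^bsub>transport_alg \<phi> S A\<^esub> \<phi> x = \<phi> (c \<odot>\<^bsub>A\<^esub> x)"
    "x \<in> S \<Longrightarrow> der (transport_alg \<phi> S A) d (\<phi> x) = \<phi> (der A d x)"
  using assms by (simp_all add: transport_alg_def Let_def)

lemma (in diff_algebra) transport_diff_algebra:
  assumes S: "diff_subalgebra K D A S" and inj: "inj_on \<phi> S"
  shows "diff_algebra K D (transport_alg \<phi> S A)"
proof -
  let ?B = "transport_alg \<phi> S A"
  note T = transport_alg_simps[OF inj] and SD = diff_subalgebraD[OF S]
  have SA: "x \<in> carrier A" if "x \<in> S" for x
    using SD(1) that by blast
  have grp: "abelian_group ?B"
  proof (rule abelian_groupI)
    fix x assume "x \<in> carrier ?B"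
    then obtain a where a: "a \<in> S" "x = \<phi> a" by (auto simp: T)
    have "\<phi> (\<ominus>\<^bsub>A\<^esub> a) \<oplus>\<^bsub>?B\<^esub> x = \<zero>\<^bsub>?B\<^esub>"
      using a by (simp add: T SD SA M.M.l_neg)
    then show "\<exists>y\<in>carrier ?B. y \<oplus>\<^bsub>?B\<^esub> x = \<zero>\<^bsub>?B\<^esub>"
      using a SD(4) T(1) by blast
  qed (auto simp: T SD SA M.M.a_ac)
  have rng: "ring ?B"
    by (intro ringI grp monoidI) (auto simp: T SD SA A.m_assoc A.l_distr A.r_distr)
  have mdl: "module K ?B"
    by (intro moduleI grp K.is_cring)
      (auto simp: T SD SA M.smult_l_distr M.smult_r_distr M.smult_assoc1)
  show ?thesis
    by (intro diff_algebra.intro diff_algebra_axioms.intro mdl rng K.field_axioms)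
      (auto simp: T SD SA smult_mult_left smult_mult_right der_add der_smult der_mult)
qed

text \<open>A subalgebra \<open>R\<close> of the copy that contains the image of \<open>Y\<close>
  pulls back to a subalgebra of \<open>A\<close> inside the generated one. The pullback contains
  \<open>Y\<close>, so by minimality it is everything, and \<open>R\<close> is the whole
  copy.\<close>

lemma (in diff_algebra) transport_generated:
  assumes inj: "inj_on \<phi> (diff_generate K D A Y)" and Y: "Y \<subseteq> carrier A"
  shows "diff_generated_by K D (transport_alg \<phi> (diff_generate K D A Y) A) (\<phi> ` Y)"
proof -
  define S where "S = diff_generate K D A Y"
  have S: "diff_subalgebra K D A S"
    using diff_generate_subalgebra[OF Y] by (simp add: S_def)
  have injS: "inj_on \<phi> S" using inj by (simp add: S_def)
  let ?B = "transport_alg \<phi> S A"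
  note T = transport_alg_simps[OF injS] and SD = diff_subalgebraD[OF S]
  interpret B: diff_algebra K D ?B
    by (rule transport_diff_algebra[OF S injS])
  have YS: "Y \<subseteq> S" by (simp add: S_def diff_generate_incl)
  have YB: "\<phi> ` Y \<subseteq> carrier ?B" using YS by (auto simp: T)
  have "carrier ?B \<subseteq> R" if R: "diff_subalgebra K D ?B R" "\<phi> ` Y \<subseteq> R" for R
  proof -
    note RD = diff_subalgebraD[OF R(1)]
    have "diff_subalgebra K D A {x \<in> S. \<phi> x \<in> R}"
      using SD(1) RD(3) by (intro diff_subalgebraI)
        (auto simp: SD T simp flip: T(4-7) intro: RD subsetD[OF SD(1)])
    then have "S \<subseteq> {x \<in> S. \<phi> x \<in> R}"
      unfolding S_def using YS R(2) by (intro diff_generate_minimal) (auto simp: S_def)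
    then show ?thesis by (auto simp: T)
  qed
  then have "diff_generate K D ?B (\<phi> ` Y) = carrier ?B"
    using YB B.carrier_diff_subalgebra unfolding diff_generate_def by blast
  then show ?thesis
    using YB unfolding diff_generated_by_def S_def by simp
qed

lemma transport_hom:
  assumes "inj_on \<phi> S" "h \<in> diff_hom K D A E" "h ` carrier A \<subseteq> S"
  shows "\<phi> \<circ> h \<in> diff_hom K D A (transport_alg \<phi> S E)"
proof -
  have "h x \<in> S" if "x \<in> carrier A" for x
    using assms(3) that by blast
  then show ?thesis
    using assms(2) unfolding diff_hom_def ring_hom_def
    by (simp add: transport_alg_simps[OF assms(1)])
qed

subsection \<open>Evaluation of terms\<close>

primrec dterm_eval ::
  "('k, 'a, 'd, 'n) diff_algebra_scheme \<Rightarrow> 'a \<Rightarrow> 'a \<Rightarrow> ('k, 'd) dterm \<Rightarrow> 'a" where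
  "dterm_eval A u v (Gen b) = (if b then u else v)"
| "dterm_eval A u v One = \<one>\<^bsub>A\<^esub>"
| "dterm_eval A u v (Add s t) = dterm_eval A u v s \<oplus>\<^bsub>A\<^esub> dterm_eval A u v t"
| "dterm_eval A u v (Mult s t) = dterm_eval A u v s \<otimes>\<^bsub>A\<^esub> dterm_eval A u v t"
| "dterm_eval A u v (Scale c t) = c \<odot>\<^bsub>A\<^esub> dterm_eval A u v t"
| "dterm_eval A u v (Der d t) = der A d (dterm_eval A u v t)"

lemma (in diff_algebra) diff_generate_dterm_eval:
  assumes "u \<in> carrier A" "v \<in> carrier A"
  shows "diff_generate K D A {u, v} \<subseteq> range (dterm_eval A u v)"
proof -
  note range_evalI = range_eqI[of _ "dterm_eval A u v", OF dterm_eval.simps(2)[symmetric]]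
    range_eqI[of _ "dterm_eval A u v", OF dterm_eval.simps(3)[symmetric]]
    range_eqI[of _ "dterm_eval A u v", OF dterm_eval.simps(4)[symmetric]]
    range_eqI[of _ "dterm_eval A u v", OF dterm_eval.simps(5)[symmetric]]
    range_eqI[of _ "dterm_eval A u v", OF dterm_eval.simps(6)[symmetric]]
  \<comment> \<open>Terms may use scalars outside \<open>carrier K\<close> and operations outside
    \<open>D\<close>, so their values can leave \<open>carrier A\<close>; hence the
    intersection.\<close>
  have "diff_subalgebra K D A (carrier A \<inter> range (dterm_eval A u v))"
    by (rule diff_subalgebraI) (auto simp: der_closed intro: range_evalI)
  moreover have "{u, v} \<subseteq> carrier A \<inter> range (dterm_eval A u v)"
    using assms range_eqI[of u "dterm_eval A u v" "Gen True"]
      range_eqI[of v "dterm_eval A u v" "Gen False"] by simp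
  ultimately show ?thesis
    using diff_generate_minimal by blast
qed

text \<open>Moves an embedding into an algebra over an arbitrary type to the carrier type of term
  sets. Each element of the generated subalgebra is replaced by the set of all terms with that
  value.\<close>

lemma two_generated_dterm_copy:
  fixes K :: "('k, 'm) ring_scheme"
    and A :: "('k, 'a, 'd, 'n) diff_algebra_scheme"
    and E :: "('k, 'b, 'd, 'o) diff_algebra_scheme"
  assumes E: "diff_algebra K D E"
    and uv: "u \<in> carrier E" "v \<in> carrier E"
    and h: "h \<in> diff_hom K D A E" "inj_on h (carrier A)"
    and img: "h ` carrier A \<subseteq> diff_generate K D E {u, v}"
  shows "\<exists>B :: ('k, ('k, 'd) dterm set, 'd) diff_algebra.
           diff_algebra K D B \<and> two_diff_generated K D B \<and>
           (\<exists>h \<in> diff_hom K D A B. inj_on h (carrier A))"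
proof -
  interpret E: diff_algebra K D E by (rule E)
  define S where "S = diff_generate K D E {u, v}"
  define \<phi> where "\<phi> = (\<lambda>x. {t :: ('k, 'd) dterm. dterm_eval E u v t = x})"
  \<comment> \<open>Fibres over distinct points are disjoint, and over \<open>S\<close> they are
    nonempty because every generated element is the value of a term.\<close>
  have inj: "inj_on \<phi> S"
  proof (rule inj_onI)
    fix x y assume "x \<in> S" and eq: "\<phi> x = \<phi> y"
    then obtain t where "dterm_eval E u v t = x"
      using E.diff_generate_dterm_eval[OF uv] unfolding S_def by blast
    then have "t \<in> \<phi> x" by (simp add: \<phi>_def)
    then have "t \<in> \<phi> y" using eq by simp
    then show "x = y" using \<open>dterm_eval E u v t = x\<close> by (simp add: \<phi>_def)
  qed
  have S: "diff_subalgebra K D E S"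
    unfolding S_def using uv by (intro E.diff_generate_subalgebra) auto
  let ?B = "transport_alg \<phi> S E"
  have "diff_algebra K D ?B"
    by (rule E.transport_diff_algebra[OF S inj])
  moreover have "diff_generated_by K D ?B (\<phi> ` {u, v})"
    using E.transport_generated[of \<phi> "{u, v}"] inj uv by (simp add: S_def)
  then have "two_diff_generated K D ?B"
    unfolding two_diff_generated_def by (simp; blast)
  moreover have "\<phi> \<circ> h \<in> diff_hom K D A ?B"
    using transport_hom[OF inj h(1)] img by (simp add: S_def)
  moreover have "inj_on (\<phi> \<circ> h) (carrier A)"
    using h(2) img inj by (intro comp_inj_on) (auto simp: S_def intro: inj_on_subset)
  ultimately show ?thesis by blast
qed

subsection \<open>Endomorphism algebras\<close>

text \<open>Values off \<open>carrier M\<close> are left free, so that the unrestricted maps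
  \<open>\<delta> d\<close> qualify as well; \<open>end_alg\<close> adds extensionality.\<close>

definition module_end ::
  "('k, 'm) ring_scheme \<Rightarrow> ('k, 'v, 'n) module_scheme \<Rightarrow> ('v \<Rightarrow> 'v) set" where
  "module_end K M =
     {f \<in> carrier M \<rightarrow> carrier M.
        (\<forall>x\<in>carrier M. \<forall>y\<in>carrier M. f (x \<oplus>\<^bsub>M\<^esub> y) = f x \<oplus>\<^bsub>M\<^esub> f y) \<and>
        (\<forall>c\<in>carrier K. \<forall>x\<in>carrier M. f (c \<odot>\<^bsub>M\<^esub> x) = c \<odot>\<^bsub>M\<^esub> f x)}"

lemma module_endD:
  assumes "f \<in> module_end K M"
  shows "x \<in> carrier M \<Longrightarrow> f x \<in> carrier M"
    and "\<lbrakk>x \<in> carrier M; y \<in> carrier M\<rbrakk> \<Longrightarrow> f (x \<oplus>\<^bsub>M\<^esub> y) = f x \<oplus>\<^bsub>M\<^esub> f y"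
    and "\<lbrakk>c \<in> carrier K; x \<in> carrier M\<rbrakk> \<Longrightarrow> f (c \<odot>\<^bsub>M\<^esub> x) = c \<odot>\<^bsub>M\<^esub> f x"
  using assms by (auto simp: module_end_def)

lemma (in module) module_end_minus:
  assumes f: "f \<in> module_end R M" and xy: "x \<in> carrier M" "y \<in> carrier M"
  shows "f (x \<ominus>\<^bsub>M\<^esub> y) = f x \<ominus>\<^bsub>M\<^esub> f y"
proof -
  have neg: "\<ominus>\<^bsub>M\<^esub> z = (\<ominus> \<one>) \<odot>\<^bsub>M\<^esub> z" if "z \<in> carrier M" for z
    using that by (simp add: smult_l_minus)
  have "f (\<ominus>\<^bsub>M\<^esub> y) = \<ominus>\<^bsub>M\<^esub> f y"
    using xy neg by (simp add: module_endD[OF f])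
  then show ?thesis
    using xy by (simp add: module_endD[OF f] M.minus_eq)
qed

text \<open>The operation \<open>d\<close> acts as the commutator with \<open>\<delta> d\<close>.
  Extensionality makes equality of elements the same as agreement on
  \<open>carrier M\<close>.\<close>

definition end_alg ::
  "('k, 'm) ring_scheme \<Rightarrow> ('k, 'v, 'n) module_scheme \<Rightarrow> ('d \<Rightarrow> 'v \<Rightarrow> 'v) \<Rightarrow>
    ('k, 'v \<Rightarrow> 'v, 'd) diff_algebra" where
  "end_alg K M \<delta> =
     \<lparr>carrier = module_end K M \<inter> extensional (carrier M),
      mult = compose (carrier M), one = \<lambda>x\<in>carrier M. x,
      zero = \<lambda>x\<in>carrier M. \<zero>\<^bsub>M\<^esub>, add = \<lambda>f g. \<lambda>x\<in>carrier M. f x \<oplus>\<^bsub>M\<^esub> g x,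
      smult = \<lambda>c f. \<lambda>x\<in>carrier M. c \<odot>\<^bsub>M\<^esub> f x,
      der = \<lambda>d f. \<lambda>x\<in>carrier M. \<delta> d (f x) \<ominus>\<^bsub>M\<^esub> f (\<delta> d x)\<rparr>"

lemma end_alg_simps:
  "carrier (end_alg K M \<delta>) = module_end K M \<inter> extensional (carrier M)"
  "f \<otimes>\<^bsub>end_alg K M \<delta>\<^esub> g = compose (carrier M) f g"
  "\<one>\<^bsub>end_alg K M \<delta>\<^esub> = (\<lambda>x\<in>carrier M. x)"
  "\<zero>\<^bsub>end_alg K M \<delta>\<^esub> = (\<lambda>x\<in>carrier M. \<zero>\<^bsub>M\<^esub>)"
  "f \<oplus>\<^bsub>end_alg K M \<delta>\<^esub> g = (\<lambda>x\<in>carrier M. f x \<oplus>\<^bsub>M\<^esub> g x)"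
  "c \<odot>\<^bsub>end_alg K M \<delta>\<^esub> f = (\<lambda>x\<in>carrier M. c \<odot>\<^bsub>M\<^esub> f x)"
  "der (end_alg K M \<delta>) d f = (\<lambda>x\<in>carrier M. \<delta> d (f x) \<ominus>\<^bsub>M\<^esub> f (\<delta> d x))"
  by (simp_all add: end_alg_def)

lemma (in module) end_alg_ops_closed:
  assumes f: "f \<in> module_end R M" and g: "g \<in> module_end R M"
  shows "compose (carrier M) f g \<in> module_end R M"
    and "(\<lambda>x\<in>carrier M. f x \<oplus>\<^bsub>M\<^esub> g x) \<in> module_end R M"
    and "(\<lambda>x\<in>carrier M. f x \<ominus>\<^bsub>M\<^esub> g x) \<in> module_end R M"
    and "c \<in> carrier R \<Longrightarrow> (\<lambda>x\<in>carrier M. c \<odot>\<^bsub>M\<^esub> f x) \<in> module_end R M"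
proof -
  note fD = module_endD[OF f] and gD = module_endD[OF g]
  show "compose (carrier M) f g \<in> module_end R M"
    by (auto simp: module_end_def compose_def fD gD)
  show "(\<lambda>x\<in>carrier M. f x \<oplus>\<^bsub>M\<^esub> g x) \<in> module_end R M"
    by (auto simp: module_end_def fD gD smult_r_distr M.a_ac)
  show "(\<lambda>x\<in>carrier M. f x \<ominus>\<^bsub>M\<^esub> g x) \<in> module_end R M"
    by (auto simp: module_end_def fD gD smult_r_distr smult_r_minus M.minus_eq M.minus_add M.a_ac)
  \<comment> \<open>Linearity of a scalar multiple rests on commutativity of the scalars.\<close>
  show "(\<lambda>x\<in>carrier M. c \<odot>\<^bsub>M\<^esub> f x) \<in> module_end R M" if "c \<in> carrier R"
    using that by (auto simp: module_end_def fD smult_r_distr m_comm simp flip: smult_assoc1)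
qed

text \<open>The commutator with any linear map is a derivation of the endomorphism ring, so mere
  linearity of each \<open>\<delta> d\<close> suffices. All identities are checked pointwise on
  \<open>carrier M\<close>.\<close>

lemma end_alg_diff_algebra:
  assumes "field K" and "module K M" and \<delta>: "\<And>d. d \<in> D \<Longrightarrow> \<delta> d \<in> module_end K M"
  shows "diff_algebra K D (end_alg K M \<delta>)"
proof -
  interpret K: field K by fact
  interpret M: module K M by fact
  let ?E = "end_alg K M \<delta>" and ?V = "carrier M"
  note E = end_alg_simps
  have closed: "f x \<in> ?V" if "f \<in> module_end K M" "x \<in> ?V" for f x
    using that by (rule module_endD)
  have ext: "f = g" if "f \<in> carrier ?E" "g \<in> carrier ?E" "\<And>x. x \<in> ?V \<Longrightarrow> f x = g x" for f g
    using that by (auto simp: E intro: extensionalityI)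
  have add: "f \<oplus>\<^bsub>?E\<^esub> g \<in> carrier ?E" and mult: "f \<otimes>\<^bsub>?E\<^esub> g \<in> carrier ?E"
    if "f \<in> carrier ?E" "g \<in> carrier ?E" for f g
    using that by (auto simp: E intro: M.end_alg_ops_closed)
  have smult: "c \<odot>\<^bsub>?E\<^esub> f \<in> carrier ?E" if "c \<in> carrier K" "f \<in> carrier ?E" for c f
    using that by (auto simp: E intro: M.end_alg_ops_closed)
  have one: "\<one>\<^bsub>?E\<^esub> \<in> carrier ?E" and zero: "\<zero>\<^bsub>?E\<^esub> \<in> carrier ?E"
    by (auto simp: E module_end_def)
  have der: "der ?E d f \<in> carrier ?E" if "d \<in> D" "f \<in> carrier ?E" for d f
  proof -
    \<comment> \<open>As a difference of two composites, the commutator falls under the closure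
      rules for endomorphisms.\<close>
    have "der ?E d f =
        (\<lambda>x\<in>?V. compose ?V (\<delta> d) f x \<ominus>\<^bsub>M\<^esub> compose ?V f (\<delta> d) x)"
      by (auto simp: E compose_def)
    then show ?thesis
      using that \<delta> by (auto simp: E intro!: M.end_alg_ops_closed)
  qed
  note closure = add mult smult one zero der
  have app:
    "x \<in> ?V \<Longrightarrow> (f \<otimes>\<^bsub>?E\<^esub> g) x = f (g x)"
    "x \<in> ?V \<Longrightarrow> \<one>\<^bsub>?E\<^esub> x = x"
    "x \<in> ?V \<Longrightarrow> \<zero>\<^bsub>?E\<^esub> x = \<zero>\<^bsub>M\<^esub>"
    "x \<in> ?V \<Longrightarrow> (f \<oplus>\<^bsub>?E\<^esub> g) x = f x \<oplus>\<^bsub>M\<^esub> g x"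
    "x \<in> ?V \<Longrightarrow> (c \<odot>\<^bsub>?E\<^esub> f) x = c \<odot>\<^bsub>M\<^esub> f x"
    "x \<in> ?V \<Longrightarrow> der ?E d f x = \<delta> d (f x) \<ominus>\<^bsub>M\<^esub> f (\<delta> d x)" for f g c d x
    by (simp_all add: E compose_def)
  have elem: "f \<in> module_end K M" if "f \<in> carrier ?E" for f
    using that by (simp add: E)
  note lin = closed[OF elem] module_endD(2,3)[OF elem] module_endD[OF \<delta>]
    M.module_end_minus[OF elem] M.module_end_minus[OF \<delta>]
  note arith = M.smult_l_distr M.smult_r_distr M.smult_assoc1 M.smult_r_minus
    M.minus_eq M.M.minus_add M.a_ac
  have grp: "abelian_group ?E"
  proof (rule abelian_groupI)
    fix f assume f: "f \<in> carrier ?E"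
    have "((\<ominus>\<^bsub>K\<^esub> \<one>\<^bsub>K\<^esub>) \<odot>\<^bsub>?E\<^esub> f) \<oplus>\<^bsub>?E\<^esub> f = \<zero>\<^bsub>?E\<^esub>"
      using f by (intro ext closure)
        (auto simp: app lin closure M.smult_l_minus M.M.l_neg)
    then show "\<exists>g\<in>carrier ?E. g \<oplus>\<^bsub>?E\<^esub> f = \<zero>\<^bsub>?E\<^esub>"
      using f smult by (meson K.a_inv_closed K.one_closed)
  qed (auto intro!: ext closure simp: app lin arith)
  have rng: "ring ?E"
    by (intro ringI grp monoidI) (auto intro!: ext closure simp: app lin)
  have mdl: "module K ?E"
    by (intro moduleI grp K.is_cring) (auto intro!: ext closure simp: app lin arith)
  show ?thesis
  proof (intro diff_algebra.intro diff_algebra_axioms.intro mdl rng \<open>field K\<close>)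
    fix d f g assume d: "d \<in> D" and f: "f \<in> carrier ?E" and g: "g \<in> carrier ?E"
    show "der ?E d (f \<otimes>\<^bsub>?E\<^esub> g) = (der ?E d f \<otimes>\<^bsub>?E\<^esub> g) \<oplus>\<^bsub>?E\<^esub> (f \<otimes>\<^bsub>?E\<^esub> der ?E d g)"
    proof (rule ext)
      fix x assume x: "x \<in> ?V"
      \<comment> \<open>On the right the mixed term \<open>f (\<delta> d (g x))\<close> appears once
        with each sign and cancels.\<close>
      show "der ?E d (f \<otimes>\<^bsub>?E\<^esub> g) x =
          ((der ?E d f \<otimes>\<^bsub>?E\<^esub> g) \<oplus>\<^bsub>?E\<^esub> (f \<otimes>\<^bsub>?E\<^esub> der ?E d g)) x"
        using d f g x
        by (simp add: app lin) (simp add: lin M.minus_eq M.M.a_assoc M.M.r_neg1 M.M.r_neg2)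
    qed (use d f g in \<open>auto intro!: closure\<close>)
  qed (auto intro!: ext closure simp: app lin arith)
qed

subsection \<open>Function modules\<close>

text \<open>The direct power of \<open>M\<close> indexed by a whole type: all functions, with no
  condition of finite support.\<close>

definition fun_module :: "('k, 'a, 'n) module_scheme \<Rightarrow> ('k, 'i \<Rightarrow> 'a) module" where
  "fun_module M =
     \<lparr>carrier = {v. \<forall>i. v i \<in> carrier M},
      mult = \<lambda>v w i. v i \<otimes>\<^bsub>M\<^esub> w i, one = \<lambda>i. \<one>\<^bsub>M\<^esub>,
      zero = \<lambda>i. \<zero>\<^bsub>M\<^esub>, add = \<lambda>v w i. v i \<oplus>\<^bsub>M\<^esub> w i,
      smult = \<lambda>c v i. c \<odot>\<^bsub>M\<^esub> v i\<rparr>"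

lemma fun_module_simps:
  "v \<in> carrier (fun_module M) \<longleftrightarrow> (\<forall>i. v i \<in> carrier M)"
  "\<zero>\<^bsub>fun_module M\<^esub> = (\<lambda>i. \<zero>\<^bsub>M\<^esub>)"
  "v \<oplus>\<^bsub>fun_module M\<^esub> w = (\<lambda>i. v i \<oplus>\<^bsub>M\<^esub> w i)"
  "c \<odot>\<^bsub>fun_module M\<^esub> v = (\<lambda>i. c \<odot>\<^bsub>M\<^esub> v i)"
  by (simp_all add: fun_module_def)

lemma (in module) fun_module: "module R (fun_module M)"
proof (intro moduleI abelian_groupI)
  fix v :: "'i \<Rightarrow> 'c" assume v: "v \<in> carrier (fun_module M)"
  then show "\<exists>w\<in>carrier (fun_module M). w \<oplus>\<^bsub>fun_module M\<^esub> v = \<zero>\<^bsub>fun_module M\<^esub>"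
    by (intro bexI[of _ "\<lambda>i. \<ominus>\<^bsub>M\<^esub> v i"]) (auto simp: fun_module_simps M.l_neg)
qed (auto simp: fun_module_simps smult_l_distr smult_r_distr smult_assoc1 M.a_ac is_cring)

lemma (in module) fun_module_minus:
  fixes v w :: "'i \<Rightarrow> 'c"
  assumes "v \<in> carrier (fun_module M)" "w \<in> carrier (fun_module M)"
  shows "v \<ominus>\<^bsub>fun_module M\<^esub> w = (\<lambda>i. v i \<ominus>\<^bsub>M\<^esub> w i)"
proof -
  interpret F: module R "fun_module M :: ('a, 'i \<Rightarrow> 'c) module" by (rule fun_module)
  have "\<ominus>\<^bsub>fun_module M\<^esub> w = (\<lambda>i. \<ominus>\<^bsub>M\<^esub> w i)"
    using assms by (intro F.M.minus_equality) (auto simp: fun_module_simps M.l_neg)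
  then show ?thesis
    by (simp add: F.M.minus_eq M.minus_eq fun_module_simps)
qed

subsection \<open>The two generators\<close>

text \<open>A function on \<open>nat list\<close> assigns a value to every stack of numbers.  Read from left to
  right, \<open>push_op (push_op step_op)^(n + 1) step_op\<close> pushes \<open>0\<close>, increments the top \<open>n + 1\<close>
  times and pops it again, multiplying by \<open>y n\<close> on the way out;
  this word never meets the stacks on which \<open>step_op\<close> is defined to be \<open>\<zero>\<close>.\<close>

definition push_op :: "(nat list \<Rightarrow> 'a) \<Rightarrow> nat list \<Rightarrow> 'a" where
  "push_op v l = v (0 # l)"

fun step_op :: "('a, 'n) ring_scheme \<Rightarrow> (nat \<Rightarrow> 'a) \<Rightarrow> (nat list \<Rightarrow> 'a) \<Rightarrow> nat list \<Rightarrow> 'a" where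
  "step_op A y v (Suc n # l) = y n \<otimes>\<^bsub>A\<^esub> v l"
| "step_op A y v (0 # n # l) = v (Suc n # l)"
| "step_op A y v _ = \<zero>\<^bsub>A\<^esub>"

text \<open>Operators act by changing the argument, so the outermost one acts on the stack first.
  The pushed \<open>0\<close> selects the second clause of \<open>step_op\<close>, which removes it
  and increments the number below; each round thus adds one to the top.\<close>

lemma push_step_power: "((\<lambda>w. push_op (step_op A y w)) ^^ m) v (n # l) = v ((n + m) # l)"
  by (induction m arbitrary: n) (simp_all add: push_op_def)

text \<open>The outer push starts the counter at \<open>0\<close>, and the rounds raise it to
  \<open>Suc n\<close>. The shift by one keeps the top nonzero, since \<open>0\<close> is the signal
  to increment; the last \<open>step_op\<close> therefore takes its first clause.\<close>

lemma push_step_word: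
  "push_op (((\<lambda>w. push_op (step_op A y w)) ^^ Suc n) (step_op A y v)) l = y n \<otimes>\<^bsub>A\<^esub> v l"
  by (simp only: push_op_def[of "_ ^^ _"] push_op_def push_step_power) (simp add: push_step_power)

lemma step_op_closed:
  assumes "ring A" "range y \<subseteq> carrier A" "\<And>i. v i \<in> carrier A"
  shows "step_op A y v l \<in> carrier A"
proof -
  interpret ring A by fact
  show ?thesis
    using assms(2,3) by (cases "(A, y, v, l)" rule: step_op.cases) auto
qed

section \<open>The stack algebra and its left multiplications\<close>

context diff_algebra
begin

abbreviation stack_module :: "('k, nat list \<Rightarrow> 'a) module" where
  "stack_module \<equiv> fun_module A"

definition stack_alg :: "('k, (nat list \<Rightarrow> 'a) \<Rightarrow> nat list \<Rightarrow> 'a, 'd) diff_algebra" where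
  "stack_alg = end_alg K stack_module (\<lambda>d v i. der A d (v i))"

definition left_mult :: "'a \<Rightarrow> (nat list \<Rightarrow> 'a) \<Rightarrow> nat list \<Rightarrow> 'a" where
  "left_mult a = (\<lambda>v\<in>carrier stack_module. \<lambda>i. a \<otimes>\<^bsub>A\<^esub> v i)"

lemma stack_alg_diff_algebra: "diff_algebra K D stack_alg"
  unfolding stack_alg_def
  by (intro end_alg_diff_algebra K.field_axioms M.fun_module)
    (auto simp: module_end_def fun_module_simps der_closed der_add der_smult)

text \<open>Compatibility with the operations is the Leibniz rule solved for its first term: d(a) v
  = d(a v) - a d(v), whose right side is the commutator of d with left multiplication by a.\<close>

lemma left_mult_hom: "left_mult \<in> diff_hom K D A stack_alg"
proof -
  have "left_mult a \<in> carrier stack_alg" if "a \<in> carrier A" for a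
    using that by (auto simp: stack_alg_def end_alg_simps left_mult_def module_end_def
        fun_module_simps A.r_distr smult_mult_right)
  moreover have "left_mult (der A d a) = der stack_alg d (left_mult a)"
    if "d \<in> D" "a \<in> carrier A" for d a
  proof (rule extensionalityI[where A = "carrier stack_module"])
    fix v :: "nat list \<Rightarrow> 'a" assume v: "v \<in> carrier stack_module"
    have "der A d a \<otimes>\<^bsub>A\<^esub> v i =
        der A d (a \<otimes>\<^bsub>A\<^esub> v i) \<ominus>\<^bsub>A\<^esub> a \<otimes>\<^bsub>A\<^esub> der A d (v i)" for i
      using that v by (simp add: der_mult der_closed fun_module_simps M.M.minus_eq M.M.a_assoc M.M.r_neg)
    then show "left_mult (der A d a) v = der stack_alg d (left_mult a) v"
      using that v
      by (simp add: stack_alg_def end_alg_simps left_mult_def M.fun_module_minus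
          fun_module_simps der_closed)
  qed (auto simp: left_mult_def stack_alg_def end_alg_simps)
  ultimately show ?thesis
    by (auto simp: diff_hom_def ring_hom_def stack_alg_def end_alg_simps left_mult_def
        compose_def fun_module_simps A.m_assoc A.l_distr smult_mult_left cong: restrict_cong)
qed

text \<open>The unit makes the representation faithful: \<open>a\<close> is recovered from its
  action on the constant function one.\<close>

lemma left_mult_inj: "inj_on left_mult (carrier A)"
proof (rule inj_onI)
  fix a b assume ab: "a \<in> carrier A" "b \<in> carrier A" "left_mult a = left_mult b"
  then have "left_mult a (\<lambda>i. \<one>\<^bsub>A\<^esub>) [] = left_mult b (\<lambda>i. \<one>\<^bsub>A\<^esub>) []"
    by simp
  then show "a = b"
    using ab by (simp add: left_mult_def fun_module_simps)
qed

text \<open>Reduces the inclusion of a whole image in a subalgebra to the images of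
  generators.\<close>

lemma hom_preimage_subalgebra:
  assumes h: "h \<in> diff_hom K D A E" and S: "diff_subalgebra K D E S"
  shows "diff_subalgebra K D A {a \<in> carrier A. h a \<in> S}"
  using h diff_subalgebraD[OF S]
  by (intro diff_subalgebraI) (auto simp: diff_hom_def ring_hom_def der_closed)

lemma push_op_in_stack_alg: "restrict push_op (carrier stack_module) \<in> carrier stack_alg"
  by (auto simp: stack_alg_def end_alg_simps module_end_def fun_module_simps push_op_def)

text \<open>The clauses only relocate values, insert zero, or multiply by \<open>y n\<close> on the
  left, and left multiplication is linear over \<open>K\<close> even for noncommutative
  \<open>A\<close>.\<close>

lemma step_op_in_stack_alg:
  assumes y: "range y \<subseteq> carrier A"
  shows "restrict (step_op A y) (carrier stack_module) \<in> carrier stack_alg"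
proof -
  have yc: "y n \<in> carrier A" for n using y by blast
  have "step_op A y (\<lambda>i. v i \<oplus>\<^bsub>A\<^esub> w i) l = step_op A y v l \<oplus>\<^bsub>A\<^esub> step_op A y w l"
    if "\<And>i. v i \<in> carrier A" "\<And>i. w i \<in> carrier A" for v w l
    using that yc by (cases "(A, y, v, l)" rule: step_op.cases) (auto simp: A.r_distr)
  moreover have "step_op A y (\<lambda>i. c \<odot>\<^bsub>A\<^esub> v i) l = c \<odot>\<^bsub>A\<^esub> step_op A y v l"
    if "c \<in> carrier K" "\<And>i. v i \<in> carrier A" for c v l
    using that yc by (cases "(A, y, v, l)" rule: step_op.cases) (auto simp: smult_mult_right)
  ultimately show ?thesis
    using step_op_closed[OF A.ring_axioms y]
    by (auto simp: stack_alg_def end_alg_simps module_end_def fun_module_simps fun_eq_iff)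
qed

text \<open>Products alone suffice: the word of \<open>push_step_word\<close> is U P W with P = (U
  W)^(n+1).\<close>

lemma left_mult_in_stack_generate:
  assumes y: "range y \<subseteq> carrier A"
  defines "U \<equiv> restrict push_op (carrier stack_module)"
    and "W \<equiv> restrict (step_op A y) (carrier stack_module)"
  shows "left_mult (y n) \<in> diff_generate K D stack_alg {U, W}"
proof -
  interpret E: diff_algebra K D stack_alg by (rule stack_alg_diff_algebra)
  define S where "S = diff_generate K D stack_alg {U, W}"
  have UW: "U \<in> carrier stack_alg" "W \<in> carrier stack_alg"
    using push_op_in_stack_alg step_op_in_stack_alg[OF y] by (simp_all add: U_def W_def)
  then have S: "diff_subalgebra K D stack_alg S"
    unfolding S_def by (intro E.diff_generate_subalgebra) auto
  have US: "U \<in> S" "W \<in> S"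
    using diff_generate_incl[of "{U, W}"] by (auto simp: S_def)
  let ?V = "carrier stack_module"
  \<comment> \<open>\<open>U\<close> and \<open>W\<close> agree with the raw operators only on
    \<open>?V\<close>, so every intermediate function must be shown to stay there.\<close>
  have push: "push_op v \<in> ?V" if "v \<in> ?V" for v
    using that by (simp add: fun_module_simps push_op_def)
  have step: "step_op A y v \<in> ?V" if "v \<in> ?V" for v
    using that step_op_closed[OF A.ring_axioms y] by (simp add: fun_module_simps)
  have mult: "(f \<otimes>\<^bsub>stack_alg\<^esub> g) v = f (g v)" if "v \<in> ?V" for f g v
    using that by (simp add: stack_alg_def end_alg_simps compose_def)
  have pow: "((\<lambda>w. push_op (step_op A y w)) ^^ m) v \<in> ?V" if "v \<in> ?V" for m v
    using that by (induction m) (auto simp: push step)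
  have "\<exists>P\<in>S. \<forall>v\<in>?V. P v = ((\<lambda>w. push_op (step_op A y w)) ^^ m) v" for m
  proof (induction m)
    case 0
    show ?case
      using diff_subalgebraD(3)[OF S]
      by (intro bexI[of _ "\<one>\<^bsub>stack_alg\<^esub>"]) (auto simp: stack_alg_def end_alg_simps)
  next
    case (Suc m)
    then obtain P where P: "P \<in> S"
      "\<And>v. v \<in> ?V \<Longrightarrow> P v = ((\<lambda>w. push_op (step_op A y w)) ^^ m) v" by blast
    have "(U \<otimes>\<^bsub>stack_alg\<^esub> (W \<otimes>\<^bsub>stack_alg\<^esub> P)) v
        = ((\<lambda>w. push_op (step_op A y w)) ^^ Suc m) v" if "v \<in> ?V" for v
      using that by (simp add: mult P pow step U_def W_def)
    then show ?case
      using P(1) US diff_subalgebraD(6)[OF S] by blast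
  qed
  then obtain P where P: "P \<in> S"
    "\<And>v. v \<in> ?V \<Longrightarrow> P v = ((\<lambda>w. push_op (step_op A y w)) ^^ Suc n) v" by blast
  have Q: "U \<otimes>\<^bsub>stack_alg\<^esub> (P \<otimes>\<^bsub>stack_alg\<^esub> W) \<in> S"
    using P(1) US diff_subalgebraD(6)[OF S] by blast
  have "left_mult (y n) = U \<otimes>\<^bsub>stack_alg\<^esub> (P \<otimes>\<^bsub>stack_alg\<^esub> W)"
  proof (rule extensionalityI[where A = ?V])
    fix v :: "nat list \<Rightarrow> 'a" assume v: "v \<in> ?V"
    have "(U \<otimes>\<^bsub>stack_alg\<^esub> (P \<otimes>\<^bsub>stack_alg\<^esub> W)) v =
        push_op (((\<lambda>w. push_op (step_op A y w)) ^^ Suc n) (step_op A y v))"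
      using v pow[OF step[OF v], of "Suc n"]
      by (simp add: mult P(2) step U_def W_def del: funpow.simps)
    then show "left_mult (y n) v = (U \<otimes>\<^bsub>stack_alg\<^esub> (P \<otimes>\<^bsub>stack_alg\<^esub> W)) v"
      using v by (simp add: left_mult_def push_step_word fun_eq_iff del: funpow.simps)
  qed (auto simp: left_mult_def stack_alg_def end_alg_simps)
  then show ?thesis using Q by (simp add: S_def)
qed

end

theorem theorem5p1:
  fixes K :: "('k, 'm) ring_scheme"
    and D :: "'d set"
    and A :: "('k, 'a, 'd, 'n) diff_algebra_scheme"
  assumes "field K"
    and "diff_algebra K D A"
    and "countably_diff_generated K D A"
  shows "\<exists>B :: ('k, ('k, 'd) dterm set, 'd) diff_algebra.
           diff_algebra K D B \<and> two_diff_generated K D B \<and>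
           (\<exists>h \<in> diff_hom K D A B. inj_on h (carrier A))"
proof -
  interpret A: diff_algebra K D A by fact
  interpret E: diff_algebra K D A.stack_alg by (rule A.stack_alg_diff_algebra)
  obtain Y where Y: "countable Y" "Y \<subseteq> carrier A" "diff_generate K D A Y = carrier A"
    using assms(3) unfolding countably_diff_generated_def diff_generated_by_def by blast
  \<comment> \<open>Inserting the unit covers an empty \<open>Y\<close>: a nonempty countable set is
    the range of a sequence.\<close>
  define y where "y = from_nat_into (insert \<one>\<^bsub>A\<^esub> Y)"
  have range_y: "range y = insert \<one>\<^bsub>A\<^esub> Y"
    using Y(1) by (simp add: y_def range_from_nat_into)
  then have y: "range y \<subseteq> carrier A" using Y(2) by auto
  let ?U = "restrict push_op (carrier A.stack_module)"
  let ?W = "restrict (step_op A y) (carrier A.stack_module)"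
  let ?S = "diff_generate K D A.stack_alg {?U, ?W}"
  note UW = A.push_op_in_stack_alg A.step_op_in_stack_alg[OF y]
  have "diff_subalgebra K D A.stack_alg ?S"
    using UW by (intro E.diff_generate_subalgebra) auto
  \<comment> \<open>This preimage will contain \<open>Y\<close>, hence equal
    \<open>carrier A\<close>, so the whole image of \<open>A\<close> lies in the subalgebra
    generated by the two operators.\<close>
  then have "diff_subalgebra K D A {a \<in> carrier A. A.left_mult a \<in> ?S}"
    by (rule A.hom_preimage_subalgebra[OF A.left_mult_hom])
  moreover have "Y \<subseteq> {a \<in> carrier A. A.left_mult a \<in> ?S}"
  proof
    fix a assume "a \<in> Y"
    then obtain n where "a = y n" using range_y by blast
    then show "a \<in> {a \<in> carrier A. A.left_mult a \<in> ?S}"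
      using A.left_mult_in_stack_generate[OF y] y by auto
  qed
  ultimately have "A.left_mult ` carrier A \<subseteq> ?S"
    using diff_generate_minimal Y(3) by blast
  then show ?thesis
    by (rule two_generated_dterm_copy[OF A.stack_alg_diff_algebra UW A.left_mult_hom A.left_mult_inj])
qed

end
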